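(* Suppose $\Omega \subseteq \mathcal{X}\times\mathbb{R}^m$ has the constraint satisfaction property (a) and the disturbance invariance property (b) stated in the context. Let $x_n \in \mathcal{X}$ and suppose $\mathcal{M}_n = \{c_n,\ldots,c_{n+N-1},\theta_n\}$ is a feasible point of the LBMPC problem at time $n$ with state $x_n$. Let $\mathcal{M}_n^*$ be a minimizing point of the LBMPC problem at time $n$ with state $x_n$, apply the control $u_n = Kx_n + c_n[\mathcal{M}_n^*]$ to the true system, and let $x_{n+1} = Ax_n + Bu_n + g(x_n,u_n)$. Then: (a) Robust feasibility: there exists a feasible point $\mathcal{M}_{n+1}$ of the LBMPC problem at time $n+1$ with state $x_{n+1}$; (b) Robust constraint satisfaction: $x_{n+1}\in\mathcal{X}$.
   Context: Polytopes are convex and compact. Minkowski sum: $\mathcal{S}\oplus\mathcal{T}=\{s+t: s\in\mathcal{S}, t\in\mathcal{T}\}$. Pontryagin difference: $\mathcal{S}\ominus\mathcal{T}=\{s: \{s\}\oplus\mathcal{T}\subseteq\mathcal{S}\}$. For a matrix $T$, $T\mathcal{S}=\{Ts: s\in\mathcal{S}\}$. True system: $x_{n+1}=Ax_n+Bu_n+g(x_n,u_n)$ with $x_n\in\mathbb{R}^p$, $u_n\in\mathbb{R}^m$; $\mathcal{X}\subset\mathbb{R}^p$, $\mathcal{U}\subset\mathbb{R}^m$ and $\mathcal{W}\subset\mathbb{R}^p$ are polytopes, $\mathcal{X}$ and $\mathcal{U}$ are the state and input constraint sets, and $g(x,u)\in\mathcal{W}$ for all $(x,u)\in\mathcal{X}\times\mathcal{U}$.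 The pair $(A,B)$ is stabilizable, and $K$ is a gain such that $A+BK$ is Schur stable (all eigenvalues of magnitude strictly less than one). $\Lambda\in\mathbb{R}^{p\times m}$, $\Psi\in\mathbb{R}^{m\times m}$ are full column-rank matrices parametrizing the steady states $\overline{x}_s=\Lambda\theta$, $\overline{u}_s=\Psi\theta$, $\theta\in\mathbb{R}^m$, i.e. $\mathrm{range}([\Lambda'\ \Psi']')=\mathrm{null}([(\mathbb{I}-A)\ \ -B])$, where $'$ denotes transpose. Properties of $\Omega\subseteq\mathcal{X}\times\mathbb{R}^m$: (a) constraint satisfaction: $\Omega\subseteq\{(\overline{x},\theta): \overline{x}\in\mathcal{X};\ \Lambda\theta\in\mathcal{X};\ K\overline{x}+(\Psi-K\Lambda)\theta\in\mathcal{U};\ \Psi\theta\in\mathcal{U}\}$; (b) disturbance invariance: $\begin{bmatrix}A+BK & B(\Psi-K\Lambda)\\ 0&\mathbb{I}\end{bmatrix}\Omega\oplus(\mathcal{W}\times\{0\})\subseteq\Omega$. Let $N\ge 1$ be the horizon, $\mathcal{I}=\{0,\ldots,N-1\}$, $\mathcal{R}_0=\{0\}$, $\mathcal{R}_i=\bigoplus_{j=0}^{i-1}(A+BK)^j\mathcal{W}$. For each $n$, the oracle $\mathcal{O}_n:\mathbb{R}^p\times\mathbb{R}^m\to\mathbb{R}^p$ is an arbitrary function and $\psi_n$ is a non-negative cost that is Lipschitz continuous in its arguments (over the bounded ranges of states and inputs, so that e.g. linear and quadratic costs are admitted). LBMPC problem at time $n$ with state $x_n$: minimize over $c=(c_n,\ldots,c_{n+N-1})$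 with $c_{n+i}\in\mathbb{R}^m$, and $\theta\in\mathbb{R}^m$, the cost $$\psi_n(\theta,\tilde{x}_n,\ldots,\tilde{x}_{n+N},\check{u}_n,\ldots,\check{u}_{n+N-1})$$ subject to $\tilde{x}_n=x_n$, $\overline{x}_n=x_n$, and for all $i\in\mathcal{I}$: $\tilde{x}_{n+i+1}=A\tilde{x}_{n+i}+B\check{u}_{n+i}+\mathcal{O}_n(\tilde{x}_{n+i},\check{u}_{n+i})$; $\overline{x}_{n+i+1}=A\overline{x}_{n+i}+B\check{u}_{n+i}$; $\check{u}_{n+i}=K\overline{x}_{n+i}+c_{n+i}$; $\overline{x}_{n+i+1}\in\mathcal{X}\ominus\mathcal{R}_{i+1}$; $\check{u}_{n+i}\in\mathcal{U}\ominus K\mathcal{R}_i$; and $(\overline{x}_{n+N},\theta)\in\Omega\ominus(\mathcal{R}_N\times\{0\})$. A feasible point is a pair $\mathcal{M}_n=(c,\theta)$ satisfying all constraints; $c_n[\mathcal{M}_n]$ denotes its first component $c_n$. *)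

theory Defs
  imports "HOL-Analysis.Analysis"
begin

text \<open>Minkowski sums of sets are written \<open>S + T\<close>, using the instance of \<open>plus\<close> on sets from
  \<open>HOL-Library.Set_Algebras\<close>. In the corresponding monoid on sets the zero is \<open>{0}\<close>, so a finite
  Minkowski sum over an empty index set is \<open>{0}\<close>.\<close>

definition pontryagin_diff :: "'a::plus set \<Rightarrow> 'a set \<Rightarrow> 'a set" (infixl \<open>\<ominus>\<close> 65) where
  "S \<ominus> T = {s. {s} + T \<subseteq> S}"

text \<open>The overloaded power \<open>M ^ k\<close> on \<open>real ^ 'n ^ 'n\<close> would be taken entrywise; this is the power
  with respect to the matrix product.\<close>

primrec mat_pow :: "real^'n^'n \<Rightarrow> nat \<Rightarrow> real^'n^'n" where
  "mat_pow M 0 = mat 1"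
| "mat_pow M (Suc k) = M ** mat_pow M k"

definition complex_eigenvalue :: "real^'n^'n \<Rightarrow> complex \<Rightarrow> bool" where
  "complex_eigenvalue M z \<longleftrightarrow>
     (\<exists>v::complex^'n. v \<noteq> 0 \<and> map_matrix complex_of_real M *v v = z *s v)"

definition schur_stable :: "real^'n^'n \<Rightarrow> bool" where
  "schur_stable M \<longleftrightarrow> (\<forall>z. complex_eigenvalue M z \<longrightarrow> cmod z < 1)"

definition stabilizable :: "real^'p^'p \<Rightarrow> real^'m^'p \<Rightarrow> bool" where
  "stabilizable A B \<longleftrightarrow> (\<exists>F::real^'p^'m. schur_stable (A + B ** F))"

definition steady_state_param ::
  "real^'p^'p \<Rightarrow> real^'m^'p \<Rightarrow> real^'m^'p \<Rightarrow> real^'m^'m \<Rightarrow> bool" where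
  "steady_state_param A B \<Lambda> \<Psi> \<longleftrightarrow>
     rank \<Lambda> = CARD('m) \<and> rank \<Psi> = CARD('m) \<and>
     range (\<lambda>\<theta>. (\<Lambda> *v \<theta>, \<Psi> *v \<theta>)) = {(x, u). (mat 1 - A) *v x + (- B) *v u = 0}"

definition constraint_satisfaction ::
  "real^'p^'m \<Rightarrow> real^'m^'p \<Rightarrow> real^'m^'m \<Rightarrow> (real^'p) set \<Rightarrow> (real^'m) set
    \<Rightarrow> ((real^'p) \<times> (real^'m)) set \<Rightarrow> bool" where
  "constraint_satisfaction K \<Lambda> \<Psi> X U \<Omega> \<longleftrightarrow>
     \<Omega> \<subseteq> {(x, \<theta>). x \<in> X \<and> \<Lambda> *v \<theta> \<in> X \<and> K *v x + (\<Psi> - K ** \<Lambda>) *v \<theta> \<in> U \<and> \<Psi> *v \<theta> \<in> U}"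

definition disturbance_invariance ::
  "real^'p^'p \<Rightarrow> real^'m^'p \<Rightarrow> real^'p^'m \<Rightarrow> real^'m^'p \<Rightarrow> real^'m^'m \<Rightarrow> (real^'p) set
    \<Rightarrow> ((real^'p) \<times> (real^'m)) set \<Rightarrow> bool" where
  "disturbance_invariance A B K \<Lambda> \<Psi> W \<Omega> \<longleftrightarrow>
     (\<lambda>(x, \<theta>). ((A + B ** K) *v x + (B ** (\<Psi> - K ** \<Lambda>)) *v \<theta>, \<theta>)) ` \<Omega> + W \<times> {0} \<subseteq> \<Omega>"

definition reach_set ::
  "real^'p^'p \<Rightarrow> real^'m^'p \<Rightarrow> real^'p^'m \<Rightarrow> (real^'p) set \<Rightarrow> nat \<Rightarrow> (real^'p) set" where
  "reach_set A B K W i = (\<Sum>j<i. (*v) (mat_pow (A + B ** K) j) ` W)"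

text \<open>A cost takes \<open>\<theta>\<close>, the list of the \<open>N + 1\<close> learned states and the list of the \<open>N\<close> inputs; only
  its values on lists of these lengths matter. It is required to be Lipschitz on every bounded set of
  arguments. All norms on the (finite-dimensional) product space being equivalent, the sum of the
  norms of the components is used.\<close>

definition lipschitz_cost ::
  "nat \<Rightarrow> (real^'m \<Rightarrow> (real^'p) list \<Rightarrow> (real^'m) list \<Rightarrow> real) \<Rightarrow> bool" where
  "lipschitz_cost N \<psi> \<longleftrightarrow>
     (\<forall>r. \<exists>L. \<forall>\<theta> \<theta>' xs xs' us us'.
        length xs = N + 1 \<and> length xs' = N + 1 \<and> length us = N \<and> length us' = N \<and>
        norm \<theta> \<le> r \<and> norm \<theta>' \<le> r \<and>
        (\<forall>x\<in>set xs \<union> set xs'. norm x \<le> r) \<and> (\<forall>u\<in>set us \<union> set us'. norm u \<le> r) \<longrightarrow>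
        \<bar>\<psi> \<theta> xs us - \<psi> \<theta>' xs' us'\<bar>
          \<le> L * (norm (\<theta> - \<theta>') + (\<Sum>i<N + 1. norm (xs ! i - xs' ! i))
                 + (\<Sum>i<N. norm (us ! i - us' ! i))))"

definition nonneg_cost ::
  "nat \<Rightarrow> (real^'m \<Rightarrow> (real^'p) list \<Rightarrow> (real^'m) list \<Rightarrow> real) \<Rightarrow> bool" where
  "nonneg_cost N \<psi> \<longleftrightarrow> (\<forall>\<theta> xs us. length xs = N + 1 \<and> length us = N \<longrightarrow> 0 \<le> \<psi> \<theta> xs us)"

text \<open>The constraints of the LBMPC problem with current state \<open>x\<close>, where \<open>orc\<close> is the learned model
  used at the current time. The lists \<open>xt\<close>, \<open>xb\<close>, \<open>uc\<close> hold the learned states, the nominal states and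
  the inputs; their \<open>i\<close>-th entries belong to the time \<open>i\<close> steps after the current one.\<close>

definition lbmpc_constraints ::
  "real^'p^'p \<Rightarrow> real^'m^'p \<Rightarrow> real^'p^'m \<Rightarrow> (real^'p) set \<Rightarrow> (real^'m) set \<Rightarrow> (real^'p) set
    \<Rightarrow> ((real^'p) \<times> (real^'m)) set \<Rightarrow> nat \<Rightarrow> (real^'p \<Rightarrow> real^'m \<Rightarrow> real^'p) \<Rightarrow> real^'p
    \<Rightarrow> (real^'m) list \<times> (real^'m) \<Rightarrow> (real^'p) list \<Rightarrow> (real^'p) list \<Rightarrow> (real^'m) list \<Rightarrow> bool" where
  "lbmpc_constraints A B K X U W \<Omega> N orc x M xt xb uc \<longleftrightarrow>
     (case M of (c, \<theta>) \<Rightarrow>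
       length c = N \<and> length xt = N + 1 \<and> length xb = N + 1 \<and> length uc = N \<and>
       xt ! 0 = x \<and> xb ! 0 = x \<and>
       (\<forall>i<N.
          xt ! (i + 1) = A *v (xt ! i) + B *v (uc ! i) + orc (xt ! i) (uc ! i) \<and>
          xb ! (i + 1) = A *v (xb ! i) + B *v (uc ! i) \<and>
          uc ! i = K *v (xb ! i) + c ! i \<and>
          xb ! (i + 1) \<in> X \<ominus> reach_set A B K W (i + 1) \<and>
          uc ! i \<in> U \<ominus> (*v) K ` reach_set A B K W i) \<and>
       (xb ! N, \<theta>) \<in> \<Omega> \<ominus> (reach_set A B K W N \<times> {0}))"

definition lbmpc_feasible ::
  "real^'p^'p \<Rightarrow> real^'m^'p \<Rightarrow> real^'p^'m \<Rightarrow> (real^'p) set \<Rightarrow> (real^'m) set \<Rightarrow> (real^'p) set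
    \<Rightarrow> ((real^'p) \<times> (real^'m)) set \<Rightarrow> nat \<Rightarrow> (real^'p \<Rightarrow> real^'m \<Rightarrow> real^'p) \<Rightarrow> real^'p
    \<Rightarrow> (real^'m) list \<times> (real^'m) \<Rightarrow> bool" where
  "lbmpc_feasible A B K X U W \<Omega> N orc x M \<longleftrightarrow>
     (\<exists>xt xb uc. lbmpc_constraints A B K X U W \<Omega> N orc x M xt xb uc)"

text \<open>The lists \<open>xt\<close>, \<open>xb\<close>, \<open>uc\<close> are determined by \<open>x\<close> and \<open>M\<close> through the constraints, so the cost
  is a function of the decision variables \<open>M\<close>.\<close>

definition lbmpc_minimizer ::
  "real^'p^'p \<Rightarrow> real^'m^'p \<Rightarrow> real^'p^'m \<Rightarrow> (real^'p) set \<Rightarrow> (real^'m) set \<Rightarrow> (real^'p) set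
    \<Rightarrow> ((real^'p) \<times> (real^'m)) set \<Rightarrow> nat \<Rightarrow> (real^'p \<Rightarrow> real^'m \<Rightarrow> real^'p)
    \<Rightarrow> (real^'m \<Rightarrow> (real^'p) list \<Rightarrow> (real^'m) list \<Rightarrow> real) \<Rightarrow> real^'p
    \<Rightarrow> (real^'m) list \<times> (real^'m) \<Rightarrow> bool" where
  "lbmpc_minimizer A B K X U W \<Omega> N orc \<psi> x M \<longleftrightarrow>
     (\<exists>xt xb uc. lbmpc_constraints A B K X U W \<Omega> N orc x M xt xb uc \<and>
       (\<forall>M' xt' xb' uc'. lbmpc_constraints A B K X U W \<Omega> N orc x M' xt' xb' uc' \<longrightarrow>
          \<psi> (snd M) xt uc \<le> \<psi> (snd M') xt' uc'))"

end

theory Submission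
  imports Defs
begin

text \<open>Shift the optimal plan by one step and close it with the feedback
  \<open>K x + (\<Psi> - K \<Lambda>) \<theta>\<close>, keeping \<open>\<theta>\<close>. With \<open>F = A + B K\<close>, the disturbance \<open>w = g x u\<close> displaces the
  nominal states of the shifted plan by \<open>F\<^sup>i w\<close>, which the tightening of the constraints from
  \<open>\<R>\<^sub>i\<close> to \<open>\<R>\<^sub>i\<^sub>+\<^sub>1 = \<R>\<^sub>i \<oplus> F\<^sup>i \<W>\<close> absorbs. The final step stays feasible by disturbance invariance,
  since also \<open>\<R>\<^sub>N = F \<R>\<^sub>N\<^sub>-\<^sub>1 \<oplus> \<W>\<close>.\<close>

lemma mem_pontryagin_diff_iff: "s \<in> S \<ominus> T \<longleftrightarrow> (\<forall>t\<in>T. s + t \<in> S)"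
  unfolding pontryagin_diff_def set_plus_def by auto

text \<open>This is the mechanism of constraint tightening: a margin \<open>T + T'\<close> can pay
  for a known displacement \<open>t'\<close> out of \<open>T'\<close> and still leaves the margin
  \<open>T\<close>.\<close>

lemma pontryagin_diff_shift:
  fixes s :: "'a::ab_semigroup_add"
  assumes "s \<in> S \<ominus> (T + T')" and "t' \<in> T'"
  shows "s + t' \<in> S \<ominus> T"
  unfolding mem_pontryagin_diff_iff
proof
  fix t assume "t \<in> T"
  with assms(2) have "t + t' \<in> T + T'" by blast
  with assms(1) have "s + (t + t') \<in> S" by (simp add: mem_pontryagin_diff_iff)
  then show "s + t' + t \<in> S" by (simp add: ac_simps)
qed

lemma Times_zero_set_plus:
  fixes S T :: "'a::plus set"
  shows "(S + T) \<times> {0::'b::monoid_add} = S \<times> {0} + T \<times> {0}"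
  by (force simp: set_plus_def)

lemma image_matrix_set_plus:
  fixes M :: "real^'n^'m"
  shows "(*v) M ` (S + T) = (*v) M ` S + (*v) M ` T"
  by (force simp: set_plus_def matrix_vector_right_distrib)

lemma image_matrix_set_sum:
  fixes M :: "real^'n^'m" and S :: "nat \<Rightarrow> (real^'n) set"
  shows "(*v) M ` (\<Sum>j<k. S j) = (\<Sum>j<k. (*v) M ` S j)"
  by (induction k) (simp_all add: image_matrix_set_plus)

lemma reach_set_0: "reach_set A B K W 0 = {0}"
  by (simp add: reach_set_def)

lemma reach_set_Suc:
  "reach_set A B K W (Suc i) = reach_set A B K W i + (*v) (mat_pow (A + B ** K) i) ` W"
  by (simp add: reach_set_def)

text \<open>Splitting off the term at 0 instead of the last one gives the shape "image under
  \<open>A + B ** K\<close>, plus \<open>W\<close>", the one that disturbance invariance can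
  absorb.\<close>

lemma reach_set_Suc_shift:
  "reach_set A B K W (Suc i) = W + (*v) (A + B ** K) ` reach_set A B K W i"
  unfolding reach_set_def sum.lessThan_Suc_shift image_matrix_set_sum
  by (simp add: image_image matrix_vector_mul_assoc)

text \<open>The oracle only drives the learned states, which are unconstrained, so it does not affect
  feasibility.\<close>

lemma lbmpc_feasibleI:
  fixes y :: "nat \<Rightarrow> real^'p" and v c :: "nat \<Rightarrow> real^'m"
  assumes "y 0 = x"
    and "\<And>i. i < N \<Longrightarrow> y (Suc i) = A *v y i + B *v v i"
    and "\<And>i. i < N \<Longrightarrow> v i = K *v y i + c i"
    and "\<And>i. i < N \<Longrightarrow> y (Suc i) \<in> X \<ominus> reach_set A B K W (Suc i)"
    and "\<And>i. i < N \<Longrightarrow> v i \<in> U \<ominus> (*v) K ` reach_set A B K W i"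
    and "(y N, \<theta>) \<in> \<Omega> \<ominus> (reach_set A B K W N \<times> {0})"
  shows "lbmpc_feasible A B K X U W \<Omega> N orc x (map c [0..<N], \<theta>)"
proof -
  define z where "z = rec_nat x (\<lambda>i z. A *v z + B *v v i + orc z (v i))"
  have "z 0 = x" "\<And>i. z (Suc i) = A *v z i + B *v v i + orc (z i) (v i)"
    by (simp_all add: z_def)
  with assms have "lbmpc_constraints A B K X U W \<Omega> N orc x (map c [0..<N], \<theta>)
      (map z [0..<N + 1]) (map y [0..<N + 1]) (map v [0..<N])"
    unfolding lbmpc_constraints_def by (simp del: upt_Suc)
  then show ?thesis unfolding lbmpc_feasible_def by blast
qed

lemma disturbance_invarianceD:
  assumes "disturbance_invariance A B K \<Lambda> \<Psi> W \<Omega>" and "(y, \<theta>) \<in> \<Omega>" and "w \<in> W"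
  shows "((A + B ** K) *v y + (B ** (\<Psi> - K ** \<Lambda>)) *v \<theta> + w, \<theta>) \<in> \<Omega>"
proof -
  let ?h = "\<lambda>(x, \<theta>). ((A + B ** K) *v x + (B ** (\<Psi> - K ** \<Lambda>)) *v \<theta>, \<theta>)"
  have "?h (y, \<theta>) + (w, 0) \<in> ?h ` \<Omega> + W \<times> {0}"
    using assms(2,3) by (intro set_plus_intro imageI) auto
  with assms(1) show ?thesis unfolding disturbance_invariance_def by auto
qed

text \<open>Covers the one step by which the new plan outlasts the old one. Each perturbed state
  \<open>y + r\<close> with \<open>r\<close> in the reach set still lies in \<open>\<Omega>\<close>
  together with \<open>\<theta>\<close>, so both properties of \<open>\<Omega>\<close> apply to it
  pointwise.\<close>

lemma terminal_step:
  fixes y :: "real^'p" and \<theta> :: "real^'m"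
  assumes "constraint_satisfaction K \<Lambda> \<Psi> X U \<Omega>"
    and "disturbance_invariance A B K \<Lambda> \<Psi> W \<Omega>"
    and y: "(y, \<theta>) \<in> \<Omega> \<ominus> (reach_set A B K W k \<times> {0})"
    and v_def: "v = K *v y + (\<Psi> - K ** \<Lambda>) *v \<theta>"
  shows "v \<in> U \<ominus> (*v) K ` reach_set A B K W k"
    and "(A *v y + B *v v, \<theta>) \<in> \<Omega> \<ominus> (reach_set A B K W (Suc k) \<times> {0})"
    and "A *v y + B *v v \<in> X \<ominus> reach_set A B K W (Suc k)"
proof -
  have \<Omega>: "(y + r, \<theta>) \<in> \<Omega>" if "r \<in> reach_set A B K W k" for r
    using y that unfolding mem_pontryagin_diff_iff by force
  have "v + K *v r \<in> U" if "r \<in> reach_set A B K W k" for r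
  proof -
    have "K *v (y + r) + (\<Psi> - K ** \<Lambda>) *v \<theta> \<in> U"
      using assms(1) \<Omega>[OF that] unfolding constraint_satisfaction_def by auto
    then show ?thesis by (simp add: v_def matrix_vector_right_distrib ac_simps)
  qed
  then show "v \<in> U \<ominus> (*v) K ` reach_set A B K W k"
    by (auto simp: mem_pontryagin_diff_iff)
  have next_\<Omega>: "(A *v y + B *v v + r, \<theta>) \<in> \<Omega>" if r: "r \<in> reach_set A B K W (Suc k)" for r
  proof -
    obtain w s where w: "w \<in> W" and s: "s \<in> reach_set A B K W k"
      and r_eq: "r = w + (A + B ** K) *v s"
      using r unfolding reach_set_Suc_shift set_plus_def by auto
    \<comment> \<open>The part \<open>s\<close> of \<open>r\<close> is counted as a perturbation of
      \<open>y\<close>, which stays in \<open>\<Omega>\<close>; the part \<open>w\<close> is the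
      fresh disturbance.\<close>
    have "A *v y + B *v v + r
        = (A + B ** K) *v (y + s) + (B ** (\<Psi> - K ** \<Lambda>)) *v \<theta> + w"
      by (simp add: r_eq v_def matrix_vector_right_distrib matrix_vector_mult_add_rdistrib
          algebra_simps flip: matrix_vector_mul_assoc)
    with disturbance_invarianceD[OF assms(2) \<Omega>[OF s] w] show ?thesis by simp
  qed
  then show "(A *v y + B *v v, \<theta>) \<in> \<Omega> \<ominus> (reach_set A B K W (Suc k) \<times> {0})"
    by (auto simp: mem_pontryagin_diff_iff)
  show "A *v y + B *v v \<in> X \<ominus> reach_set A B K W (Suc k)"
    using next_\<Omega> assms(1) unfolding mem_pontryagin_diff_iff constraint_satisfaction_def by auto
qed

text \<open>At \<open>i = 0\<close> the input constraint is not tightened, since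
  \<open>\<R>\<^sub>0 = {0}\<close>, and the margin of the next state is exactly
  \<open>\<R>\<^sub>1 = \<W>\<close>.\<close>

lemma lbmpc_constraints_first_step:
  assumes "lbmpc_constraints A B K X U W \<Omega> N orc x (c, \<theta>) xt xb uc" and "N \<ge> 1"
    and "u = K *v x + c ! 0"
  shows "u \<in> U" and "w \<in> W \<Longrightarrow> A *v x + B *v u + w \<in> X"
proof -
  have "u \<in> U \<ominus> (*v) K ` reach_set A B K W 0"
    and "A *v x + B *v u \<in> X \<ominus> reach_set A B K W (Suc 0)"
    using assms by (force simp: lbmpc_constraints_def)+
  then show "u \<in> U" and "w \<in> W \<Longrightarrow> A *v x + B *v u + w \<in> X"
    by (auto simp: mem_pontryagin_diff_iff reach_set_Suc reach_set_0 simp del: set_zero)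
qed

lemma lbmpc_shifted_feasible:
  fixes A :: "real^'p^'p" and B :: "real^'m^'p" and K :: "real^'p^'m"
  assumes con: "lbmpc_constraints A B K X U W \<Omega> N orc x (c, \<theta>) xt xb uc" and "N \<ge> 1"
    and cs: "constraint_satisfaction K \<Lambda> \<Psi> X U \<Omega>"
    and inv: "disturbance_invariance A B K \<Lambda> \<Psi> W \<Omega>"
    and "w \<in> W" and u_def: "u = K *v x + c ! 0"
  shows "\<exists>M'. lbmpc_feasible A B K X U W \<Omega> N orc' (A *v x + B *v u + w) M'"
proof -
  define F where "F = A + B ** K"
  obtain k where N: "N = Suc k" using \<open>N \<ge> 1\<close> by (cases N) auto
  have xb0: "xb ! 0 = x"
    and xb_Suc: "\<And>i. i < N \<Longrightarrow> xb ! Suc i = A *v (xb ! i) + B *v (uc ! i)"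
    and uc: "\<And>i. i < N \<Longrightarrow> uc ! i = K *v (xb ! i) + c ! i"
    and xb_X: "\<And>i. i < N \<Longrightarrow> xb ! Suc i \<in> X \<ominus> reach_set A B K W (Suc i)"
    and uc_U: "\<And>i. i < N \<Longrightarrow> uc ! i \<in> U \<ominus> (*v) K ` reach_set A B K W i"
    and xb_\<Omega>: "(xb ! N, \<theta>) \<in> \<Omega> \<ominus> (reach_set A B K W N \<times> {0})"
    using con by (auto simp: lbmpc_constraints_def)
  have w_img: "mat_pow F i *v w \<in> (*v) (mat_pow (A + B ** K) i) ` W" for i
    using \<open>w \<in> W\<close> by (simp add: F_def)
  \<comment> \<open>With \<open>K *v y0 k\<close> added, the last correction yields the steady-state
    tracking input \<open>\<Psi>\<theta> + K (y0 k - \<Lambda>\<theta>)\<close>.\<close>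
  define c' where "c' i = (if i < k then c ! Suc i else (\<Psi> - K ** \<Lambda>) *v \<theta>)" for i
  \<comment> \<open>The feedback term makes the gap between new and old nominal states evolve by
    \<open>F\<close>, starting from \<open>w\<close>.\<close>
  define y0 where "y0 i = xb ! Suc i + mat_pow F i *v w" for i
  define v where "v i = K *v y0 i + c' i" for i
  \<comment> \<open>The old nominal states end at \<open>xb ! Suc k\<close>, so \<open>y0\<close>
    serves only up to \<open>k\<close>, and the state at \<open>N = Suc k\<close> comes from the
    dynamics.\<close>
  define y where "y i = (if i \<le> k then y0 i else A *v y0 k + B *v v k)" for i
  have v_less: "v i = uc ! Suc i + K *v (mat_pow F i *v w)" if "i < k" for i
    using that by (simp add: v_def y0_def c'_def uc N matrix_vector_right_distrib)
  have y0_Suc: "y0 (Suc i) = A *v y0 i + B *v v i" if "i < k" for i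
  proof -
    have "mat_pow F (Suc i) *v w = F *v (mat_pow F i *v w)"
      by (simp add: matrix_vector_mul_assoc)
    also have "F *v (mat_pow F i *v w)
        = A *v (mat_pow F i *v w) + B *v (K *v (mat_pow F i *v w))"
      by (simp add: F_def matrix_vector_mult_add_rdistrib flip: matrix_vector_mul_assoc)
    finally have step: "mat_pow F (Suc i) *v w
        = A *v (mat_pow F i *v w) + B *v (K *v (mat_pow F i *v w))" .
    from that show ?thesis
      by (simp add: y0_def step v_less xb_Suc[of "Suc i"] N matrix_vector_right_distrib algebra_simps
          del: mat_pow.simps)
  qed
  have y_less: "y0 (Suc i) \<in> X \<ominus> reach_set A B K W (Suc i)" if "i < k" for i
    unfolding y0_def using that xb_X[of "Suc i"] w_img
    by (intro pontryagin_diff_shift[where T' = "(*v) (mat_pow (A + B ** K) (Suc i)) ` W"])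
       (simp_all add: N reach_set_Suc[of A B K W "Suc i"] del: mat_pow.simps)
  have v_U_less: "v i \<in> U \<ominus> (*v) K ` reach_set A B K W i" if "i < k" for i
    unfolding v_less[OF that] using that uc_U[of "Suc i"] w_img
    by (intro pontryagin_diff_shift) (auto simp: N reach_set_Suc image_matrix_set_plus)
  \<comment> \<open>The old terminal constraint has margin
    \<open>\<R>\<^sub>N = \<R>\<^sub>k \<oplus> F\<^sup>k \<W>\<close>; the displacement
    \<open>F\<^sup>k w\<close> uses up the last summand.\<close>
  have y0_\<Omega>: "(y0 k, \<theta>) \<in> \<Omega> \<ominus> (reach_set A B K W k \<times> {0})"
    using pontryagin_diff_shift[of "(xb ! N, \<theta>)" \<Omega> "reach_set A B K W k \<times> {0}"
        "(*v) (mat_pow (A + B ** K) k) ` W \<times> {0}" "(mat_pow F k *v w, 0)"] xb_\<Omega> w_img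
    by (simp add: N reach_set_Suc Times_zero_set_plus y0_def)
  have v_k: "v k = K *v y0 k + (\<Psi> - K ** \<Lambda>) *v \<theta>"
    by (simp add: v_def c'_def)
  note terminal = terminal_step[OF cs inv y0_\<Omega> v_k]
  have "lbmpc_feasible A B K X U W \<Omega> N orc' (A *v x + B *v u + w) (map c' [0..<N], \<theta>)"
  proof (rule lbmpc_feasibleI[of y _ _ _ _ v])
    show "y 0 = A *v x + B *v u + w"
      by (simp add: y_def y0_def xb_Suc uc xb0 N u_def)
    show "(y N, \<theta>) \<in> \<Omega> \<ominus> (reach_set A B K W N \<times> {0})"
      using terminal(2) by (simp add: y_def N)
  next
    fix i assume "i < N"
    then consider "i < k" | "i = k" using N by linarith
    note i_cases = this
    from i_cases show "y (Suc i) = A *v y i + B *v v i"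
      by cases (simp_all add: y_def y0_Suc)
    from \<open>i < N\<close> show "v i = K *v y i + c' i"
      by (simp add: y_def v_def N)
    from i_cases show "y (Suc i) \<in> X \<ominus> reach_set A B K W (Suc i)"
      by cases (use y_less terminal(3) in \<open>simp_all add: y_def\<close>)
    from i_cases show "v i \<in> U \<ominus> (*v) K ` reach_set A B K W i"
      by cases (use v_U_less terminal(1) in simp_all)
  qed
  then show ?thesis ..
qed

theorem theorem1:
  fixes A :: "real^'p^'p" and B :: "real^'m^'p" and K :: "real^'p^'m"
    and \<Lambda> :: "real^'m^'p" and \<Psi> :: "real^'m^'m"
    and X W :: "(real^'p) set" and U :: "(real^'m) set" and \<Omega> :: "((real^'p) \<times> (real^'m)) set"
    and g :: "real^'p \<Rightarrow> real^'m \<Rightarrow> real^'p"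
    and Orc :: "nat \<Rightarrow> real^'p \<Rightarrow> real^'m \<Rightarrow> real^'p"
    and \<psi> :: "nat \<Rightarrow> real^'m \<Rightarrow> (real^'p) list \<Rightarrow> (real^'m) list \<Rightarrow> real"
    and N n :: nat
    and x x_next :: "real^'p" and u :: "real^'m"
    and M M_opt :: "(real^'m) list \<times> (real^'m)"
  assumes "polytope X" and "polytope U" and "polytope W"
    and "\<And>y v. y \<in> X \<Longrightarrow> v \<in> U \<Longrightarrow> g y v \<in> W"
    and "stabilizable A B" and "schur_stable (A + B ** K)"
    and "steady_state_param A B \<Lambda> \<Psi>"
    and "N \<ge> 1"
    and "\<And>k. nonneg_cost N (\<psi> k)" and "\<And>k. lipschitz_cost N (\<psi> k)"
    and "\<Omega> \<subseteq> X \<times> UNIV"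
    and "constraint_satisfaction K \<Lambda> \<Psi> X U \<Omega>"
    and "disturbance_invariance A B K \<Lambda> \<Psi> W \<Omega>"
    and "x \<in> X"
    and "lbmpc_feasible A B K X U W \<Omega> N (Orc n) x M"
    and "lbmpc_minimizer A B K X U W \<Omega> N (Orc n) (\<psi> n) x M_opt"
    and "u = K *v x + fst M_opt ! 0"
    and "x_next = A *v x + B *v u + g x u"
  shows "(\<exists>M_next. lbmpc_feasible A B K X U W \<Omega> N (Orc (n + 1)) x_next M_next) \<and> x_next \<in> X"
proof -
  obtain c \<theta> where M_opt: "M_opt = (c, \<theta>)" by fastforce
  obtain xt xb uc where con: "lbmpc_constraints A B K X U W \<Omega> N (Orc n) x (c, \<theta>) xt xb uc"
    using \<open>lbmpc_minimizer A B K X U W \<Omega> N (Orc n) (\<psi> n) x M_opt\<close>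
    unfolding lbmpc_minimizer_def M_opt by blast
  have u: "u = K *v x + c ! 0"
    using \<open>u = K *v x + fst M_opt ! 0\<close> by (simp add: M_opt)
  note first_step = lbmpc_constraints_first_step[OF con \<open>N \<ge> 1\<close> u]
  \<comment> \<open>The bound on \<open>g\<close> holds only on \<open>X \<times> U\<close>, so
    \<open>u \<in> U\<close> has to come from the first input constraint beforehand.\<close>
  have "g x u \<in> W"
    using assms(4) \<open>x \<in> X\<close> first_step(1) by blast
  then show ?thesis
    unfolding \<open>x_next = A *v x + B *v u + g x u\<close>
    using lbmpc_shifted_feasible[OF con \<open>N \<ge> 1\<close> _ _ _ u] first_step(2) assms(12,13) by blast
qed

end
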